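(* Let $X$ and $Y$ be Banach spaces, let $1\le p<\infty$, and let $Z=X\oplus_p Y$. Then $Z$ has the Ball Dentable Property ($BDP$) if and only if $X$ or $Y$ has $BDP$.
   Context: Banach spaces $X,Y$ are real and nontrivial; $B_X$ is the closed unit ball of $X$. $X\oplus_p Y$ is $X\times Y$ with norm $\|(x,y)\|=(\|x\|^p+\|y\|^p)^{1/p}$. A slice of $B_X$ is a set $S(B_X,x^*,\alpha)=\{x\in B_X: x^*(x)>\sup x^*(B_X)-\alpha\}$ with $x^*\in X^*$, $\|x^*\|=1$, $\alpha>0$. $X$ has $BDP$ if $B_X$ has slices of arbitrarily small diameter (for every $\varepsilon>0$ there is a slice of $B_X$ of diameter less than $\varepsilon$). *)

theory Defs
  imports "HOL-Analysis.Analysis"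
begin

text \<open>The norm of a space is an explicit argument \<open>N\<close> of the notions below, because the exponent
  \<open>p\<close> of the \<open>p\<close>-sum is a real variable, whereas the library norm on a product type is always the
  Euclidean one. A normed type is the instance \<open>N = norm\<close>; for it, \<open>BDP_norm_iff\<close> below recovers
  the formulation with continuous dual, closed unit ball and diameter of the library.\<close>

definition unit_ball :: "('a::real_vector \<Rightarrow> real) \<Rightarrow> 'a set" where
  "unit_ball N = {x. N x \<le> 1}"

definition dual_space :: "('a::real_vector \<Rightarrow> real) \<Rightarrow> ('a \<Rightarrow> real) set" where
  "dual_space N = {f. linear f \<and> (\<exists>K. \<forall>x. \<bar>f x\<bar> \<le> K * N x)}"

definition dual_norm :: "('a::real_vector \<Rightarrow> real) \<Rightarrow> ('a \<Rightarrow> real) \<Rightarrow> real" where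
  "dual_norm N f = (SUP x\<in>unit_ball N. \<bar>f x\<bar>)"

definition slice :: "('a::real_vector \<Rightarrow> real) \<Rightarrow> ('a \<Rightarrow> real) \<Rightarrow> real \<Rightarrow> 'a set" where
  "slice N f \<alpha> = {x \<in> unit_ball N. f x > (SUP y\<in>unit_ball N. f y) - \<alpha>}"

definition norm_diameter :: "('a::real_vector \<Rightarrow> real) \<Rightarrow> 'a set \<Rightarrow> real" where
  "norm_diameter N S = (if S = {} then 0 else SUP (x, y)\<in>S \<times> S. N (x - y))"

definition BDP :: "('a::real_vector \<Rightarrow> real) \<Rightarrow> bool" where
  "BDP N \<longleftrightarrow> (\<forall>\<epsilon>>0. \<exists>f\<in>dual_space N. dual_norm N f = 1 \<and>
     (\<exists>\<alpha>>0. norm_diameter N (slice N f \<alpha>) < \<epsilon>))"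

definition psum_norm :: "real \<Rightarrow> 'a::real_normed_vector \<times> 'b::real_normed_vector \<Rightarrow> real" where
  "psum_norm p z = (norm (fst z) powr p + norm (snd z) powr p) powr (1 / p)"

lemma dual_norm_blinfun:
  fixes f :: "'a::real_normed_vector \<Rightarrow>\<^sub>L real"
  shows "dual_norm norm (blinfun_apply f) = norm f"
  unfolding dual_norm_def
proof (rule cSup_eq_non_empty)
  show "(\<lambda>x. \<bar>blinfun_apply f x\<bar>) ` unit_ball norm \<noteq> {}"
    by (auto simp: unit_ball_def intro!: exI[of _ 0])
  fix y assume "y \<in> (\<lambda>x. \<bar>blinfun_apply f x\<bar>) ` unit_ball norm"
  then obtain x where x: "norm x \<le> 1" "y = norm (blinfun_apply f x)"
    by (auto simp: unit_ball_def)
  have "norm f * norm x \<le> norm f" using x(1) by (simp add: mult_left_le)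
  then show "y \<le> norm f" using norm_blinfun[of f x] x(2) by linarith
next
  fix y assume y: "\<And>x. x \<in> (\<lambda>x. \<bar>blinfun_apply f x\<bar>) ` unit_ball norm \<Longrightarrow> x \<le> y"
  have y': "\<bar>blinfun_apply f x\<bar> \<le> y" if "norm x \<le> 1" for x
    using y that by (auto simp: unit_ball_def)
  have y0: "0 \<le> y" using y'[of 0] by simp
  show "norm f \<le> y"
  proof (rule norm_blinfun_bound[OF y0])
    fix x show "norm (blinfun_apply f x) \<le> y * norm x"
    proof (cases "x = 0")
      case False
      have "\<bar>blinfun_apply f (x /\<^sub>R norm x)\<bar> \<le> y" by (rule y') (use False in simp)
      then show ?thesis using False by (simp add: blinfun.scaleR_right abs_mult field_simps)
    qed simp
  qed
qed

lemma dual_space_norm: "dual_space norm = range (blinfun_apply :: 'a::real_normed_vector \<Rightarrow>\<^sub>L real \<Rightarrow> _)"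
proof (intro equalityI subsetI)
  fix f :: "'a \<Rightarrow> real" assume "f \<in> dual_space norm"
  then have "bounded_linear f"
    by (auto simp: dual_space_def bounded_linear_def bounded_linear_axioms_def linear_conv_bounded_linear
        mult.commute)
  then have "f = blinfun_apply (Blinfun f)" by (simp add: bounded_linear_Blinfun_apply)
  then show "f \<in> range blinfun_apply" by blast
next
  fix f :: "'a \<Rightarrow> real" assume "f \<in> range blinfun_apply"
  then obtain g where g: "f = blinfun_apply g" by blast
  have "\<forall>x. \<bar>g x\<bar> \<le> norm g * norm x" using norm_blinfun[of g] by simp
  then show "f \<in> dual_space norm"
    unfolding g dual_space_def using blinfun.bounded_linear_right[of g]
    by (auto simp: bounded_linear_def)
qed

lemma BDP_norm_iff:
  "BDP (norm :: 'a::real_normed_vector \<Rightarrow> real) \<longleftrightarrow>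
     (\<forall>\<epsilon>>0. \<exists>f :: 'a \<Rightarrow>\<^sub>L real. norm f = 1 \<and>
        (\<exists>\<alpha>>0. diameter {x \<in> cball 0 1. blinfun_apply f x > (SUP y\<in>cball 0 1. blinfun_apply f y) - \<alpha>} < \<epsilon>))"
proof -
  have "unit_ball norm = (cball 0 1 :: 'a set)" by (auto simp: unit_ball_def)
  then show ?thesis
    by (simp add: BDP_def dual_space_norm dual_norm_blinfun slice_def norm_diameter_def
        diameter_def dist_norm)
qed

lemma convex_on_powr:
  fixes p :: real assumes "1 \<le> p" shows "convex_on {0..} (\<lambda>x. x powr p)"
proof (rule convex_onI)
  fix t x y :: real assume t: "0 < t" "t < 1" and x: "x \<in> {0..}" and y: "y \<in> {0..}"
  have le: "t powr p \<le> t" if "0 < t" "t < 1" for t :: real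
    using powr_mono'[of 1 p t] that assms by simp
  consider "x = 0" | "y = 0" | "0 < x" "0 < y" using x y by fastforce
  then show "((1 - t) *\<^sub>R x + t *\<^sub>R y) powr p \<le> (1 - t) * x powr p + t * y powr p"
  proof cases
    case 1
    then show ?thesis using le[of t] t y by (simp add: powr_mult mult_right_mono)
  next
    case 2
    then show ?thesis using le[of "1 - t"] t x by (simp add: powr_mult mult_right_mono)
  next
    case 3
    then show ?thesis using convex_onD[OF powr_convex[OF assms], of t x y] t by simp
  qed
qed simp

lemma psum_norm_eq_0_iff: "psum_norm p z = 0 \<longleftrightarrow> z = 0"
  by (cases z) (auto simp: psum_norm_def add_nonneg_eq_0_iff zero_prod_def)

lemma psum_norm_scaleR:
  assumes "1 \<le> p" shows "psum_norm p (c *\<^sub>R z) = \<bar>c\<bar> * psum_norm p z"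
proof -
  have "(\<bar>c\<bar> powr p * (norm (fst z) powr p + norm (snd z) powr p)) powr (1 / p)
      = \<bar>c\<bar> * (norm (fst z) powr p + norm (snd z) powr p) powr (1 / p)"
    using assms by (simp add: powr_mult powr_powr)
  then show ?thesis by (simp add: psum_norm_def powr_mult distrib_left)
qed

lemma psum_norm_triangle:
  assumes p: "1 \<le> p" shows "psum_norm p (z + w) \<le> psum_norm p z + psum_norm p w"
proof (cases "z = 0 \<or> w = 0")
  case True
  then show ?thesis by (auto simp: psum_norm_def)
next
  case False
  define s t where "s = psum_norm p z" and "t = psum_norm p w"
  have "s \<ge> 0" "t \<ge> 0" by (auto simp: s_def t_def psum_norm_def)
  with False have st: "s > 0" "t > 0"
    using psum_norm_eq_0_iff[of p z] psum_norm_eq_0_iff[of p w] by (auto simp: s_def t_def)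
  define u where "u = s / (s + t)"
  have u: "0 < u" "u < 1" "1 - u = t / (s + t)" using st by (auto simp: u_def field_simps)
  have pw: "s powr p = norm (fst z) powr p + norm (snd z) powr p"
    "t powr p = norm (fst w) powr p + norm (snd w) powr p"
    using p by (auto simp: s_def t_def psum_norm_def powr_powr)
  have *: "((a + b) / (s + t)) powr p \<le> u * (a powr p / s powr p) + (1 - u) * (b powr p / t powr p)"
    if "a \<ge> 0" "b \<ge> 0" for a b
  proof -
    have "(u * (a / s) + (1 - u) * (b / t)) powr p \<le> u * (a / s) powr p + (1 - u) * (b / t) powr p"
      using convex_onD[OF convex_on_powr[OF p], of "1 - u" "a / s" "b / t"] u(1,2) that st by simp
    moreover have "u * (a / s) + (1 - u) * (b / t) = (a + b) / (s + t)"
      unfolding u(3) using st by (simp add: u_def add_divide_distrib)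
    ultimately show ?thesis using that st by (simp add: powr_divide)
  qed
  let ?A = "norm (fst z)" and ?B = "norm (snd z)" and ?C = "norm (fst w)" and ?D = "norm (snd w)"
  have "((?A + ?C) / (s + t)) powr p + ((?B + ?D) / (s + t)) powr p
      \<le> u * ((?A powr p + ?B powr p) / s powr p) + (1 - u) * ((?C powr p + ?D powr p) / t powr p)"
    using *[of ?A ?C] *[of ?B ?D] by (simp add: add_divide_distrib distrib_left)
  also have "\<dots> = 1" using st by (simp flip: pw)
  finally have "(?A + ?C) powr p + (?B + ?D) powr p \<le> (s + t) powr p"
    using st by (simp add: powr_divide flip: add_divide_distrib)
  moreover have "norm (fst (z + w)) powr p \<le> (?A + ?C) powr p" "norm (snd (z + w)) powr p \<le> (?B + ?D) powr p"
    using p by (auto intro!: powr_mono2 norm_triangle_ineq)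
  ultimately have "norm (fst (z + w)) powr p + norm (snd (z + w)) powr p \<le> (s + t) powr p" by linarith
  then have "psum_norm p (z + w) \<le> ((s + t) powr p) powr (1 / p)"
    unfolding psum_norm_def using p by (intro powr_mono2) auto
  then show ?thesis using p st by (simp add: powr_powr s_def t_def)
qed

end

theory Submission
  imports Defs
begin

text \<open>The proof rests on replacing slices by caps: the parts of the unit ball on which a bounded
  linear functional exceeds a constant. Caps are insensitive to rescaling the functional, and in a
  nontrivial space \<open>BDP\<close> says exactly that there are nonempty caps of arbitrarily small diameter
  (\<open>BDP_iff_small_cap\<close>): a nonempty cap of a nonzero functional is a slice of the normalized
  functional, while a nonempty cap of the zero functional is the whole ball, whose diameter is two.

  If \<open>X\<close> has small slices, lift a functional \<open>f\<close> of norm one on \<open>X\<close> to \<open>z \<mapsto> f (fst z)\<close>.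
  Where the lift is close to one, the first coordinate of \<open>z\<close> has norm close to one, and because
  \<open>p\<close> is finite the second coordinate is small. Two points of such a cap therefore differ
  essentially only in their first coordinates, which lie in a small slice of the ball of \<open>X\<close>
  (\<open>small_cap_psum_fst\<close>).

  Conversely, let a cap of the ball of the sum be small. It contains a point \<open>(x0, y0)\<close> of the unit
  sphere, and one of its coordinates, say \<open>x0\<close>, has norm \<open>s\<close> at least one half. Freezing
  \<open>y0\<close>, the map \<open>x \<mapsto> (s x, y0)\<close> sends the ball of \<open>X\<close> into the ball of the sum and
  multiplies distances by \<open>s\<close>, so the preimage of the cap is a nonempty cap of the ball of \<open>X\<close>
  at most twice as large (\<open>small_cap_affine_section\<close>). Which of the two spaces is found may depend
  on the prescribed diameter, but one of them must be found for arbitrarily small diameters.\<close>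

section \<open>Slices and caps of the unit ball\<close>

text \<open>The cap is required to meet the unit sphere, and not merely to be nonempty, so that a point
  with a coordinate of substantial norm can be taken from a cap of a sum.\<close>

definition has_small_cap :: "('v::real_vector \<Rightarrow> real) \<Rightarrow> real \<Rightarrow> bool" where
  "has_small_cap N \<epsilon> \<longleftrightarrow> (\<exists>f\<in>dual_space N. \<exists>c. (\<exists>x. N x = 1 \<and> c < f x) \<and>
     (\<forall>x y. N x \<le> 1 \<longrightarrow> N y \<le> 1 \<longrightarrow> c < f x \<longrightarrow> c < f y \<longrightarrow> N (x - y) \<le> \<epsilon>))"

lemma has_small_cap_mono: "has_small_cap N \<epsilon> \<Longrightarrow> \<epsilon> \<le> \<delta> \<Longrightarrow> has_small_cap N \<delta>"
  unfolding has_small_cap_def by (meson order_trans)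

lemma norm_diameter_le:
  assumes "\<And>x y. x \<in> S \<Longrightarrow> y \<in> S \<Longrightarrow> N (x - y) \<le> d" and "0 \<le> d"
  shows "norm_diameter N S \<le> d"
  using assms unfolding norm_diameter_def by (auto intro!: cSUP_least)

locale explicit_norm =
  fixes N :: "'v::real_vector \<Rightarrow> real"
  assumes scaleR: "N (c *\<^sub>R x) = \<bar>c\<bar> * N x"
    and triangle: "N (x + y) \<le> N x + N y"
    and eq_0_iff: "N x = 0 \<longleftrightarrow> x = 0"
begin

lemma minus: "N (- x) = N x"
  using scaleR[of "-1" x] by simp

lemma diff_triangle: "N (x - y) \<le> N x + N y"
  using triangle[of x "- y"] by (simp add: minus)

lemma nonneg: "0 \<le> N x"
  using diff_triangle[of x x] eq_0_iff[of 0] by simp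

lemma normalized: "x \<noteq> 0 \<Longrightarrow> N (x /\<^sub>R N x) = 1"
  using nonneg[of x] eq_0_iff[of x] by (simp add: scaleR)

lemma unit_ball_nonempty: "unit_ball N \<noteq> {}"
proof -
  have "0 \<in> unit_ball N" using eq_0_iff[of 0] by (simp add: unit_ball_def)
  then show ?thesis by blast
qed

lemma bdd_above_dual:
  assumes "f \<in> dual_space N"
  shows "bdd_above ((\<lambda>x. \<bar>f x\<bar>) ` unit_ball N)"
proof -
  obtain K where K: "\<And>x. \<bar>f x\<bar> \<le> K * N x" using assms by (auto simp: dual_space_def)
  have "\<bar>f x\<bar> \<le> \<bar>K\<bar>" if "N x \<le> 1" for x
  proof -
    have "K * N x \<le> \<bar>K\<bar> * N x" using nonneg[of x] by (intro mult_right_mono) auto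
    also have "\<dots> \<le> \<bar>K\<bar>" using that by (simp add: mult_left_le)
    finally show ?thesis using K[of x] by linarith
  qed
  then show ?thesis by (auto simp: unit_ball_def bdd_above_def)
qed

lemma dual_norm_upper:
  assumes "f \<in> dual_space N" "N x \<le> 1"
  shows "\<bar>f x\<bar> \<le> dual_norm N f"
  unfolding dual_norm_def
  by (rule cSUP_upper[OF _ bdd_above_dual[OF assms(1)]]) (simp add: unit_ball_def assms)

lemma dual_norm_bound:
  assumes f: "f \<in> dual_space N"
  shows "\<bar>f x\<bar> \<le> dual_norm N f * N x"
proof (cases "x = 0")
  case True
  then show ?thesis using f eq_0_iff[of 0] linear_0[of f] by (simp add: dual_space_def)
next
  case False
  then have "N x > 0" using nonneg[of x] eq_0_iff[of x] by linarith
  moreover have "\<bar>f (x /\<^sub>R N x)\<bar> \<le> dual_norm N f"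
    using dual_norm_upper[OF f] normalized[OF False] by simp
  ultimately show ?thesis
    using f linear_scale[of f] by (simp add: dual_space_def abs_mult field_simps)
qed

text \<open>Both the sign and the length of a point that almost attains the norm can be corrected:
  normalizing a vector of the ball on which \<open>f\<close> is nonnegative does not decrease \<open>f\<close>.\<close>

lemma almost_norming_unit_vector:
  assumes f: "f \<in> dual_space N" and c: "0 \<le> c" "c < dual_norm N f"
  obtains x where "N x = 1" "c < f x"
proof -
  have lin: "linear f" using f by (simp add: dual_space_def)
  then obtain y where y: "N y \<le> 1" "c < \<bar>f y\<bar>"
    using c(2) less_cSUP_iff[OF unit_ball_nonempty bdd_above_dual[OF f], of c]
    by (auto simp: dual_norm_def unit_ball_def)
  obtain x where x: "N x \<le> 1" "c < f x"
  proof (cases "0 \<le> f y")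
    case True then show ?thesis using y that[of y] by simp
  next
    case False then show ?thesis using y that[of "- y"] linear_neg[OF lin, of y] by (simp add: minus)
  qed
  have "x \<noteq> 0" using x c linear_0[OF lin] by auto
  then have "N x > 0" using nonneg[of x] eq_0_iff[of x] by linarith
  have "c * N x \<le> c" using c x by (simp add: mult_left_le)
  then have "c < f x / N x" using x \<open>N x > 0\<close> by (simp add: pos_less_divide_eq)
  then have "c < f (x /\<^sub>R N x)" using linear_scale[OF lin] by (simp add: divide_inverse mult.commute)
  then show ?thesis using that normalized[OF \<open>x \<noteq> 0\<close>] by blast
qed

text \<open>The ball is symmetric, so the absolute value in the dual norm does not change the supremum.\<close>

lemma SUP_unit_ball_eq_dual_norm:
  assumes f: "f \<in> dual_space N"
  shows "(SUP x\<in>unit_ball N. f x) = dual_norm N f"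
proof (rule antisym)
  have le: "f x \<le> dual_norm N f" if "x \<in> unit_ball N" for x
    using dual_norm_upper[OF f, of x] that by (auto simp: unit_ball_def)
  then show "(SUP x\<in>unit_ball N. f x) \<le> dual_norm N f" by (intro cSUP_least unit_ball_nonempty)
  have bdd: "bdd_above (f ` unit_ball N)" using le by (auto simp: bdd_above_def)
  show "dual_norm N f \<le> (SUP x\<in>unit_ball N. f x)"
    unfolding dual_norm_def
  proof (rule cSUP_least[OF unit_ball_nonempty])
    fix x assume x: "x \<in> unit_ball N"
    have "- x \<in> unit_ball N" using x by (simp add: unit_ball_def minus)
    moreover have "f (- x) = - f x" using f linear_neg[of f] by (simp add: dual_space_def)
    ultimately show "\<bar>f x\<bar> \<le> (SUP x\<in>unit_ball N. f x)"
      using cSUP_upper[OF x bdd] cSUP_upper[of "- x", OF _ bdd] by (simp add: abs_le_iff)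
  qed
qed

lemma slice_eq_cap:
  assumes "f \<in> dual_space N"
  shows "slice N f \<alpha> = {x. N x \<le> 1 \<and> dual_norm N f - \<alpha> < f x}"
  unfolding slice_def SUP_unit_ball_eq_dual_norm[OF assms] by (simp add: unit_ball_def)

lemma norm_diameter_upper:
  assumes "S \<subseteq> unit_ball N" "x \<in> S" "y \<in> S"
  shows "N (x - y) \<le> norm_diameter N S"
proof -
  have "N (u - v) \<le> 2" if "u \<in> S" "v \<in> S" for u v
  proof -
    have "N u \<le> 1" "N v \<le> 1" using that assms(1) by (auto simp: unit_ball_def)
    then show ?thesis using diff_triangle[of u v] by linarith
  qed
  then have "bdd_above ((\<lambda>(x, y). N (x - y)) ` (S \<times> S))" by (auto simp: bdd_above_def)
  from cSUP_upper[OF _ this, of "(x, y)"] show ?thesis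
    using assms by (auto simp: norm_diameter_def)
qed

lemma BDP_small_slice:
  assumes "BDP N" "0 < \<epsilon>"
  obtains f \<alpha> where "f \<in> dual_space N" "dual_norm N f = 1" "0 < \<alpha>"
    "\<And>x y. N x \<le> 1 \<Longrightarrow> N y \<le> 1 \<Longrightarrow> 1 - \<alpha> < f x \<Longrightarrow> 1 - \<alpha> < f y \<Longrightarrow> N (x - y) \<le> \<epsilon>"
proof -
  obtain f \<alpha> where f: "f \<in> dual_space N" "dual_norm N f = 1" and "0 < \<alpha>"
    and d: "norm_diameter N (slice N f \<alpha>) < \<epsilon>"
    using assms unfolding BDP_def by blast
  moreover have "N (x - y) \<le> \<epsilon>"
    if "N x \<le> 1" "N y \<le> 1" "1 - \<alpha> < f x" "1 - \<alpha> < f y" for x y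
  proof -
    have "N (x - y) \<le> norm_diameter N (slice N f \<alpha>)"
    proof (rule norm_diameter_upper)
      show "slice N f \<alpha> \<subseteq> unit_ball N" by (auto simp: slice_def)
    qed (use that in \<open>simp_all add: slice_eq_cap[OF f(1)] f(2)\<close>)
    then show ?thesis using d by linarith
  qed
  ultimately show ?thesis using that by blast
qed

lemma BDP_imp_small_cap:
  assumes "BDP N" "0 < \<epsilon>"
  shows "has_small_cap N \<epsilon>"
proof -
  obtain f \<alpha> where f: "f \<in> dual_space N" "dual_norm N f = 1" and "0 < \<alpha>"
    and small: "\<And>x y. N x \<le> 1 \<Longrightarrow> N y \<le> 1 \<Longrightarrow> 1 - \<alpha> < f x \<Longrightarrow> 1 - \<alpha> < f y \<Longrightarrow> N (x - y) \<le> \<epsilon>"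
    using BDP_small_slice[OF assms] by metis
  obtain x where "N x = 1" "max 0 (1 - \<alpha>) < f x"
    using almost_norming_unit_vector[OF f(1), of "max 0 (1 - \<alpha>)"] f(2) \<open>0 < \<alpha>\<close> by auto
  then show ?thesis unfolding has_small_cap_def using f(1) small by (metis max_less_iff_conj)
qed

lemma small_cap_imp_BDP:
  assumes nontrivial: "\<exists>v::'v. v \<noteq> 0" and caps: "\<And>\<epsilon>. 0 < \<epsilon> \<Longrightarrow> has_small_cap N \<epsilon>"
  shows "BDP N"
  unfolding BDP_def
proof (intro allI impI)
  fix \<epsilon> :: real assume "0 < \<epsilon>"
  \<comment> \<open>Below two, so that the whole ball is too large; below \<open>\<epsilon>\<close>, for the strict inequality.\<close>
  define \<delta> where "\<delta> = min 1 (\<epsilon> / 2)"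
  have \<delta>: "0 < \<delta>" "\<delta> < 2" "\<delta> < \<epsilon>" using \<open>0 < \<epsilon>\<close> by (auto simp: \<delta>_def)
  obtain f c x0 where f: "f \<in> dual_space N" and x0: "N x0 = 1" "c < f x0"
    and small: "\<And>x y. N x \<le> 1 \<Longrightarrow> N y \<le> 1 \<Longrightarrow> c < f x \<Longrightarrow> c < f y \<Longrightarrow> N (x - y) \<le> \<delta>"
    using caps[OF \<delta>(1)] unfolding has_small_cap_def by blast
  have lin: "linear f" using f by (simp add: dual_space_def)
  define a where "a = dual_norm N f"
  have "c < a" using x0 dual_norm_upper[OF f, of x0] by (simp add: a_def)
  have "a \<noteq> 0"
  proof
    assume "a = 0"
    then have zero: "f x = 0" for x using dual_norm_bound[OF f, of x] by (simp add: a_def)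
    have "N (x0 - - x0) \<le> \<delta>" using small[of x0 "- x0"] x0 by (simp add: zero minus)
    moreover have "N (x0 - - x0) = 2" using scaleR[of 2 x0] x0 by (simp add: scaleR_2)
    ultimately show False using \<delta> by simp
  qed
  moreover have "0 \<le> a" using dual_norm_upper[OF f, of x0] x0 by (simp add: a_def)
  ultimately have "0 < a" by simp
  define g where "g = (\<lambda>x. f x / a)"
  have g: "g \<in> dual_space N"
  proof -
    have "\<bar>g x\<bar> \<le> 1 * N x" for x
      using dual_norm_bound[OF f, of x] \<open>0 < a\<close> by (simp add: g_def a_def abs_divide field_simps)
    moreover have "linear g"
      using linear_compose_scale_right[OF lin, of "1 / a"] by (simp add: g_def)
    ultimately show ?thesis unfolding dual_space_def by blast
  qed
  have g1: "dual_norm N g = 1"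
  proof (rule antisym)
    show "dual_norm N g \<le> 1"
      unfolding dual_norm_def using dual_norm_upper[OF f] \<open>0 < a\<close>
      by (intro cSUP_least unit_ball_nonempty) (auto simp: unit_ball_def g_def a_def)
    show "1 \<le> dual_norm N g"
    proof (rule field_le_epsilon)
      fix e :: real assume "0 < e"
      have "max 0 (a - a * e) < a" using \<open>0 < a\<close> \<open>0 < e\<close> by simp
      then obtain x where x: "N x = 1" "max 0 (a - a * e) < f x"
        using almost_norming_unit_vector[OF f, of "max 0 (a - a * e)"] by (auto simp: a_def)
      then have "1 - e < g x" using \<open>0 < a\<close> by (simp add: g_def field_simps)
      then show "1 \<le> dual_norm N g + e" using dual_norm_upper[OF g, of x] x by simp
    qed
  qed
  define \<alpha> where "\<alpha> = 1 - c / a"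
  have "0 < \<alpha>" using \<open>c < a\<close> \<open>0 < a\<close> by (simp add: \<alpha>_def)
  moreover have "norm_diameter N (slice N g \<alpha>) \<le> \<delta>"
  proof (rule norm_diameter_le)
    have "slice N g \<alpha> = {x. N x \<le> 1 \<and> c < f x}"
      unfolding slice_eq_cap[OF g] g1 using \<open>0 < a\<close>
      by (simp add: \<alpha>_def g_def divide_less_cancel)
    then show "N (x - y) \<le> \<delta>" if "x \<in> slice N g \<alpha>" "y \<in> slice N g \<alpha>" for x y
      using small that by simp
  qed (use \<delta> in simp)
  ultimately show "\<exists>f\<in>dual_space N. dual_norm N f = 1 \<and> (\<exists>\<alpha>>0. norm_diameter N (slice N f \<alpha>) < \<epsilon>)"
    using g g1 \<delta>(3) by (meson le_less_trans)
qed

lemma BDP_iff_small_cap: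
  assumes "\<exists>v::'v. v \<noteq> 0"
  shows "BDP N \<longleftrightarrow> (\<forall>\<epsilon>>0. has_small_cap N \<epsilon>)"
  using small_cap_imp_BDP[OF assms] BDP_imp_small_cap by blast

end

interpretation norm: explicit_norm "norm :: 'a::real_normed_vector \<Rightarrow> real"
  by unfold_locales (auto simp: norm_triangle_ineq)

section \<open>The norm of the \<open>p\<close>-sum\<close>

lemma explicit_norm_psum: "1 \<le> p \<Longrightarrow> explicit_norm (psum_norm p)"
  by unfold_locales (auto simp: psum_norm_scaleR psum_norm_triangle psum_norm_eq_0_iff)

lemma psum_norm_Pair_0 [simp]: "1 \<le> p \<Longrightarrow> psum_norm p (x, 0) = norm x"
  by (simp add: psum_norm_def powr_powr)

lemma psum_norm_0_Pair [simp]: "1 \<le> p \<Longrightarrow> psum_norm p (0, y) = norm y"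
  by (simp add: psum_norm_def powr_powr)

lemma psum_norm_le_sum: "1 \<le> p \<Longrightarrow> psum_norm p z \<le> norm (fst z) + norm (snd z)"
  using psum_norm_triangle[of p "(fst z, 0)" "(0, snd z)"] by simp

lemma psum_norm_mono:
  assumes "1 \<le> p" "norm (fst z) \<le> norm (fst w)" "norm (snd z) \<le> norm (snd w)"
  shows "psum_norm p z \<le> psum_norm p w"
  unfolding psum_norm_def using assms by (intro powr_mono2 add_mono add_nonneg_nonneg) auto

lemma psum_norm_powr:
  assumes "1 \<le> p"
  shows "psum_norm p z powr p = norm (fst z) powr p + norm (snd z) powr p"
  using assms by (simp add: psum_norm_def powr_powr)

lemma psum_norm_swap: "psum_norm p (prod.swap z) = psum_norm p z"
  by (simp add: psum_norm_def add.commute)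

section \<open>From a summand to the sum\<close>

text \<open>A large first coordinate forces a small second one. The finiteness of \<open>p\<close> enters here: the
  threshold \<open>(1 - \<eta> powr p) powr (1 / p)\<close> for the first coordinate is less than one.\<close>

lemma small_cap_psum_fst:
  fixes p :: real
  assumes p: "1 \<le> p" and BDP: "BDP (norm :: 'a::real_normed_vector \<Rightarrow> real)" and "0 < \<epsilon>"
  shows "has_small_cap (psum_norm p :: 'a \<times> 'b::real_normed_vector \<Rightarrow> real) \<epsilon>"
proof -
  \<comment> \<open>The first coordinates contribute half of \<open>\<epsilon>\<close>, each of the two second coordinates a quarter.\<close>
  have "0 < \<epsilon> / 2" using \<open>0 < \<epsilon>\<close> by simp
  from norm.BDP_small_slice[OF BDP this]
  obtain f :: "'a \<Rightarrow> real" and \<alpha> where f: "f \<in> dual_space norm" "dual_norm norm f = 1" and "0 < \<alpha>"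
    and small: "\<And>x y. norm x \<le> 1 \<Longrightarrow> norm y \<le> 1 \<Longrightarrow> 1 - \<alpha> < f x \<Longrightarrow> 1 - \<alpha> < f y
      \<Longrightarrow> norm (x - y) \<le> \<epsilon> / 2"
    by metis
  define \<eta> where "\<eta> = min (1 / 2) (\<epsilon> / 4)"
  have \<eta>: "0 < \<eta>" "\<eta> < 1" "\<eta> \<le> \<epsilon> / 4" using \<open>0 < \<epsilon>\<close> by (auto simp: \<eta>_def)
  have \<eta>p: "0 < \<eta> powr p" "\<eta> powr p < 1" using \<eta> p powr_less_mono2[of p \<eta> 1] by auto
  define c where "c = max (1 - \<alpha>) ((1 - \<eta> powr p) powr (1 / p))"
  have "(1 - \<eta> powr p) powr (1 / p) < 1"
    using powr_less_mono2[of "1 / p" "1 - \<eta> powr p" 1] \<eta>p p by simp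
  then have c: "0 \<le> c" "c < 1" using \<open>0 < \<alpha>\<close> by (auto simp: c_def le_max_iff_disj)
  have cp: "1 - \<eta> powr p \<le> c powr p"
  proof -
    have "((1 - \<eta> powr p) powr (1 / p)) powr p \<le> c powr p"
      using p by (intro powr_mono2) (auto simp: c_def)
    then show ?thesis using \<eta>p p by (simp add: powr_powr)
  qed
  have fst_snd: "norm (fst z) \<le> 1" "norm (snd z) \<le> \<eta>" if z: "psum_norm p z \<le> 1" "c < f (fst z)"
    for z :: "'a \<times> 'b"
  proof -
    have sum: "norm (fst z) powr p + norm (snd z) powr p \<le> 1"
      using z(1) powr_mono2[of p "psum_norm p z" 1] p
      by (simp add: explicit_norm.nonneg[OF explicit_norm_psum[OF p]] flip: psum_norm_powr)
    show "norm (fst z) \<le> 1" using psum_norm_mono[OF p, of "(fst z, 0)" z] z(1) p by simp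
    have "c \<le> norm (fst z)" using norm.dual_norm_bound[OF f(1), of "fst z"] z f(2) by simp
    then have "c powr p \<le> norm (fst z) powr p" using c p by (intro powr_mono2) auto
    then have "norm (snd z) powr p \<le> \<eta> powr p" using sum cp by linarith
    then show "norm (snd z) \<le> \<eta>" using \<eta> p powr_less_mono2[of p \<eta> "norm (snd z)"] by fastforce
  qed
  have "f \<circ> fst \<in> dual_space (psum_norm p :: 'a \<times> 'b \<Rightarrow> real)"
  proof -
    have "\<bar>(f \<circ> fst) z\<bar> \<le> 1 * psum_norm p z" for z :: "'a \<times> 'b"
      using norm.dual_norm_bound[OF f(1), of "fst z"] f(2) psum_norm_mono[OF p, of "(fst z, 0)" z] p
      by simp
    moreover have "linear (f \<circ> (fst :: 'a \<times> 'b \<Rightarrow> 'a))"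
      using f(1) linear_compose[OF linear_fst] by (auto simp: dual_space_def)
    ultimately show ?thesis unfolding dual_space_def by blast
  qed
  moreover obtain x where "norm x = 1" "c < f x"
    using norm.almost_norming_unit_vector[OF f(1), of c] c f(2) by auto
  then have "psum_norm p (x, 0 :: 'b) = 1" "c < (f \<circ> fst) (x, 0 :: 'b)" using p by auto
  moreover have "psum_norm p (z - w) \<le> \<epsilon>"
    if z: "psum_norm p z \<le> 1" "c < (f \<circ> fst) z" and w: "psum_norm p w \<le> 1" "c < (f \<circ> fst) w"
    for z w :: "'a \<times> 'b"
  proof -
    have "norm (fst z - fst w) \<le> \<epsilon> / 2"
      using small[of "fst z" "fst w"] fst_snd z w by (auto simp: c_def)
    moreover have "norm (snd z - snd w) \<le> \<eta> + \<eta>"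
      using fst_snd(2)[of z] fst_snd(2)[of w] z w norm_triangle_ineq4[of "snd z" "snd w"] by simp
    ultimately show ?thesis using psum_norm_le_sum[OF p, of "z - w"] \<eta>(3) by simp
  qed
  ultimately show ?thesis unfolding has_small_cap_def by blast
qed

lemma has_small_cap_psum_swap:
  assumes "has_small_cap (psum_norm p :: 'b::real_normed_vector \<times> 'a::real_normed_vector \<Rightarrow> real) \<epsilon>"
  shows "has_small_cap (psum_norm p :: 'a \<times> 'b \<Rightarrow> real) \<epsilon>"
proof -
  obtain f :: "'b \<times> 'a \<Rightarrow> real" and c z0 where f: "f \<in> dual_space (psum_norm p)"
    and z0: "psum_norm p z0 = 1" "c < f z0"
    and small: "\<And>z w. psum_norm p z \<le> 1 \<Longrightarrow> psum_norm p w \<le> 1 \<Longrightarrow> c < f z \<Longrightarrow> c < f w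
      \<Longrightarrow> psum_norm p (z - w) \<le> \<epsilon>"
    using assms unfolding has_small_cap_def by blast
  have swap: "linear (prod.swap :: 'a \<times> 'b \<Rightarrow> 'b \<times> 'a)" by (auto intro!: linearI)
  have "f \<circ> prod.swap \<in> dual_space (psum_norm p)"
    using f linear_compose[OF swap, of f] unfolding dual_space_def
    by (auto simp: psum_norm_swap) (metis psum_norm_swap swap_simp)
  moreover have "psum_norm p (z - w) \<le> \<epsilon>" if "psum_norm p z \<le> 1" "psum_norm p w \<le> 1"
    "c < (f \<circ> prod.swap) z" "c < (f \<circ> prod.swap) w" for z w
    using small[of "prod.swap z" "prod.swap w"] that psum_norm_swap[of p "z - w"]
    by (simp add: psum_norm_swap linear_diff[OF swap])
  moreover have "psum_norm p (prod.swap z0) = 1" "c < (f \<circ> prod.swap) (prod.swap z0)"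
    using z0 by (simp_all add: psum_norm_swap)
  ultimately show ?thesis unfolding has_small_cap_def by blast
qed

section \<open>From the sum to a summand\<close>

text \<open>The preimage of a cap under an affine map is the set where the pulled back functional exceeds
  a shifted constant. If the map takes ball to ball, this preimage is again a cap, and if its linear
  part is \<open>s\<close> times an isometry, its diameter grows at most by the factor \<open>1 / s\<close>.\<close>

lemma small_cap_affine_section:
  fixes e :: "'a::real_normed_vector \<Rightarrow> 'v::real_vector"
  assumes f: "f \<in> dual_space N"
    and small: "\<And>z w. N z \<le> 1 \<Longrightarrow> N w \<le> 1 \<Longrightarrow> c < f z \<Longrightarrow> c < f w \<Longrightarrow> N (z - w) \<le> \<epsilon>"
    and e: "linear e" "\<And>x. N (e x) = s * norm x" "0 < s"
    and ball: "\<And>x. norm x \<le> 1 \<Longrightarrow> N (e x + u) \<le> 1"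
    and x0: "norm x0 = 1" "c < f (e x0 + u)"
  shows "has_small_cap (norm :: 'a \<Rightarrow> real) (\<epsilon> / s)"
proof -
  have lin: "linear f" using f by (simp add: dual_space_def)
  obtain K where K: "\<And>z. \<bar>f z\<bar> \<le> K * N z" using f by (auto simp: dual_space_def)
  have "\<bar>(f \<circ> e) x\<bar> \<le> (K * s) * norm x" for x using K[of "e x"] e(2)[of x] by simp
  then have "f \<circ> e \<in> dual_space norm"
    unfolding dual_space_def using linear_compose[OF e(1) lin] by blast
  moreover have "c - f u < (f \<circ> e) x0" using x0(2) linear_add[OF lin] by simp
  moreover have "norm (x - y) \<le> \<epsilon> / s"
    if "norm x \<le> 1" "norm y \<le> 1" "c - f u < (f \<circ> e) x" "c - f u < (f \<circ> e) y" for x y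
  proof -
    have "N ((e x + u) - (e y + u)) \<le> \<epsilon>"
      using that ball linear_add[OF lin] by (intro small) auto
    then show ?thesis using e(2)[of "x - y"] e(3) linear_diff[OF e(1)] by (simp add: field_simps)
  qed
  ultimately show ?thesis unfolding has_small_cap_def using x0(1) by blast
qed

lemma small_cap_psum_imp_summand:
  fixes p :: real
  assumes p: "1 \<le> p" and "0 < \<epsilon>"
    and cap: "has_small_cap (psum_norm p :: 'a::real_normed_vector \<times> 'b::real_normed_vector \<Rightarrow> real) (\<epsilon> / 2)"
  shows "has_small_cap (norm :: 'a \<Rightarrow> real) \<epsilon> \<or> has_small_cap (norm :: 'b \<Rightarrow> real) \<epsilon>"
proof -
  obtain f :: "'a \<times> 'b \<Rightarrow> real" and c z0 where f: "f \<in> dual_space (psum_norm p)"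
    and z0: "psum_norm p z0 = 1" "c < f z0"
    and small: "\<And>z w. psum_norm p z \<le> 1 \<Longrightarrow> psum_norm p w \<le> 1 \<Longrightarrow> c < f z \<Longrightarrow> c < f w
      \<Longrightarrow> psum_norm p (z - w) \<le> \<epsilon> / 2"
    using cap unfolding has_small_cap_def by blast
  obtain x0 y0 where xy: "z0 = (x0, y0)" by (cases z0)
  define s t where "s = norm x0" and "t = norm y0"
  have grow: "\<epsilon> / 2 / r \<le> \<epsilon>" if "1 / 2 \<le> r" for r
    using that \<open>0 < \<epsilon>\<close> by (simp add: field_simps)
  have "1 \<le> s + t" using psum_norm_le_sum[OF p, of z0] z0 by (simp add: xy s_def t_def)
  then consider "1 / 2 \<le> s" | "1 / 2 \<le> t" by linarith
  then show ?thesis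
  proof cases
    case 1
    then have "s > 0" by simp
    have "has_small_cap (norm :: 'a \<Rightarrow> real) (\<epsilon> / 2 / s)"
    proof (rule small_cap_affine_section[OF f small, where e = "\<lambda>x. (s *\<^sub>R x, 0)" and u = "(0, y0)"
          and ?x0.0 = "x0 /\<^sub>R s"])
      show "linear (\<lambda>x::'a. (s *\<^sub>R x, 0::'b))" by (auto intro!: linearI simp: scaleR_add_right)
      show "psum_norm p (s *\<^sub>R x, 0::'b) = s * norm x" for x :: 'a using p \<open>s > 0\<close> by simp
      show "psum_norm p ((s *\<^sub>R x, 0) + (0, y0)) \<le> 1" if "norm x \<le> 1" for x :: 'a
        using psum_norm_mono[OF p, of "(s *\<^sub>R x, y0)" z0] z0 that \<open>s > 0\<close>
        by (simp add: xy s_def mult_left_le)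
    qed (use z0 \<open>s > 0\<close> in \<open>auto simp: xy s_def\<close>)
    then show ?thesis using has_small_cap_mono grow[OF 1] by blast
  next
    case 2
    then have "t > 0" by simp
    have "has_small_cap (norm :: 'b \<Rightarrow> real) (\<epsilon> / 2 / t)"
    proof (rule small_cap_affine_section[OF f small, where e = "\<lambda>y. (0, t *\<^sub>R y)" and u = "(x0, 0)"
          and ?x0.0 = "y0 /\<^sub>R t"])
      show "linear (\<lambda>y::'b. (0::'a, t *\<^sub>R y))" by (auto intro!: linearI simp: scaleR_add_right)
      show "psum_norm p (0::'a, t *\<^sub>R y) = t * norm y" for y :: 'b using p \<open>t > 0\<close> by simp
      show "psum_norm p ((0, t *\<^sub>R y) + (x0, 0)) \<le> 1" if "norm y \<le> 1" for y :: 'b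
        using psum_norm_mono[OF p, of "(x0, t *\<^sub>R y)" z0] z0 that \<open>t > 0\<close>
        by (simp add: xy t_def mult_left_le)
    qed (use z0 \<open>t > 0\<close> in \<open>auto simp: xy t_def\<close>)
    then show ?thesis using has_small_cap_mono grow[OF 2] by blast
  qed
qed

section \<open>Ball dentability of \<open>p\<close>-sums\<close>

theorem proposition2p4:
  fixes p :: real
  assumes X_nontrivial: "\<exists>x :: 'a::banach. x \<noteq> 0"
    and Y_nontrivial: "\<exists>y :: 'b::banach. y \<noteq> 0"
    and p: "1 \<le> p"
  shows "BDP (psum_norm p :: 'a \<times> 'b \<Rightarrow> real) \<longleftrightarrow>
           BDP (norm :: 'a \<Rightarrow> real) \<or> BDP (norm :: 'b \<Rightarrow> real)"
proof -
  let ?Z = "psum_norm p :: 'a \<times> 'b \<Rightarrow> real"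
  interpret Z: explicit_norm ?Z by (rule explicit_norm_psum[OF p])
  have Z_nontrivial: "\<exists>z :: 'a \<times> 'b. z \<noteq> 0"
    using X_nontrivial by (auto simp: zero_prod_def)
  note BDP_Z = Z.BDP_iff_small_cap[OF Z_nontrivial]
  show ?thesis
  proof
    assume "BDP ?Z"
    then have alt: "has_small_cap (norm :: 'a \<Rightarrow> real) \<epsilon> \<or> has_small_cap (norm :: 'b \<Rightarrow> real) \<epsilon>"
      if "0 < \<epsilon>" for \<epsilon>
      using small_cap_psum_imp_summand[OF p that] BDP_Z half_gt_zero[OF that] by blast
    show "BDP (norm :: 'a \<Rightarrow> real) \<or> BDP (norm :: 'b \<Rightarrow> real)"
    proof (rule ccontr)
      assume "\<not> ?thesis"
      then obtain \<epsilon> \<delta> where "0 < \<epsilon>" and X: "\<not> has_small_cap (norm :: 'a \<Rightarrow> real) \<epsilon>"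
        and "0 < \<delta>" and Y: "\<not> has_small_cap (norm :: 'b \<Rightarrow> real) \<delta>"
        using norm.BDP_iff_small_cap[OF X_nontrivial] norm.BDP_iff_small_cap[OF Y_nontrivial]
        by blast
      from \<open>0 < \<epsilon>\<close> \<open>0 < \<delta>\<close> have "0 < min \<epsilon> \<delta>" by simp
      from alt[OF this] show False
      proof
        assume "has_small_cap (norm :: 'a \<Rightarrow> real) (min \<epsilon> \<delta>)"
        from has_small_cap_mono[OF this min.cobounded1] X show False by contradiction
      next
        assume "has_small_cap (norm :: 'b \<Rightarrow> real) (min \<epsilon> \<delta>)"
        from has_small_cap_mono[OF this min.cobounded2] Y show False by contradiction
      qed
    qed
  next
    assume "BDP (norm :: 'a \<Rightarrow> real) \<or> BDP (norm :: 'b \<Rightarrow> real)"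
    then have "has_small_cap ?Z \<epsilon>" if "0 < \<epsilon>" for \<epsilon>
    proof
      assume "BDP (norm :: 'a \<Rightarrow> real)"
      then show ?thesis using that by (rule small_cap_psum_fst[OF p])
    next
      assume "BDP (norm :: 'b \<Rightarrow> real)"
      then have "has_small_cap (psum_norm p :: 'b \<times> 'a \<Rightarrow> real) \<epsilon>"
        using that by (rule small_cap_psum_fst[OF p])
      then show ?thesis by (rule has_small_cap_psum_swap)
    qed
    then show "BDP ?Z" using BDP_Z by blast
  qed
qed

end
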